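(* Let $\Omega = \{1,2,\dots,n\}$, let $\mathcal{B} = P(\Omega)$ be the set of all subsets of $\Omega$, and let $\mu : \mathcal{B} \to [0,\infty)$ be a finite monotone measure. For $a \in (M_n(\mathbb{C}))^+$, let $\lambda(a) = (\lambda_1(a), \lambda_2(a), \dots, \lambda_n(a))$ be the list of the eigenvalues of $a$ in decreasing order $\lambda_1(a) \geq \lambda_2(a) \geq \dots \geq \lambda_n(a)$, counted with multiplicities. Define $\Phi_\mu : (M_n(\mathbb{C}))^+ \to \mathbb{C}^+ = [0,\infty)$ by $$\Phi_\mu(a) = \sum_{i=1}^{n-1} (\lambda_i(a) - \lambda_{i+1}(a))\,\mu(A_i) + \lambda_n(a)\,\mu(A_n), \qquad A_i = \{1,2,\dots,i\}.$$ Then $\Phi_\mu$ is a unitarily invariant monotone positive map (in general non-linear) such that $\Phi_\mu(\alpha a) = \alpha\,\Phi_\mu(a)$ for every positive scalar $\alpha$ and every $a \in (M_n(\mathbb{C}))^+$.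
   Context: A finite monotone measure on the finite set $\Omega$ is a function $\mu : P(\Omega) \to [0,\infty)$ with $\mu(\emptyset) = 0$ and $\mu(X) \leq \mu(Y)$ whenever $X \subset Y$ (no additivity is assumed). $(M_n(\mathbb{C}))^+$ is the cone of positive semidefinite $n\times n$ matrices. A map $\Phi$ on $(M_n(\mathbb{C}))^+$ is positive if its values are positive (here, in $[0,\infty)$), monotone if $a \leq b$ implies $\Phi(a) \leq \Phi(b)$, and unitarily invariant if $\Phi(uau^* ) = \Phi(a)$ for every unitary $u \in M_n(\mathbb{C})$. "Non-linear" means not necessarily linear. (The paper denotes $\Phi_\mu$ by $(C-\varphi)_\mu$.) *)

theory Defs
  imports "Jordan_Normal_Form.Char_Poly" "Jordan_Normal_Form.Schur_Decomposition"
    "HOL-Computational_Algebra.Fundamental_Theorem_Algebra" "HOL-Library.Multiset"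
begin

text \<open>The condition is imposed on subsets of \<open>\<Omega>\<close> only; the values of \<open>\<mu>\<close> elsewhere are irrelevant.
  Finiteness is built into the codomain \<open>real\<close>.\<close>

definition finite_monotone_measure :: "'a set \<Rightarrow> ('a set \<Rightarrow> real) \<Rightarrow> bool" where
  "finite_monotone_measure \<Omega> \<mu> \<longleftrightarrow>
     \<mu> {} = 0 \<and> (\<forall>X \<in> Pow \<Omega>. 0 \<le> \<mu> X) \<and>
     (\<forall>X \<in> Pow \<Omega>. \<forall>Y \<in> Pow \<Omega>. X \<subseteq> Y \<longrightarrow> \<mu> X \<le> \<mu> Y)"

text \<open>The order on \<open>complex\<close> is that of \<open>Complex_Order\<close>: \<open>0 \<le> z\<close> says that \<open>z\<close> is real and
  nonnegative.\<close>

definition psd_cone :: "nat \<Rightarrow> complex mat set" where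
  "psd_cone n = {a \<in> carrier_mat n n. mat_adjoint a = a \<and>
     (\<forall>v \<in> carrier_vec n. 0 \<le> (a *\<^sub>v v) \<bullet>c v)}"

text \<open>The order \<open>a \<le> b\<close> on matrices. The instance \<open>\<le>\<close> of the type \<open>mat\<close> is the
  entrywise order and must not be used for it.\<close>

definition loewner_le :: "nat \<Rightarrow> complex mat \<Rightarrow> complex mat \<Rightarrow> bool" where
  "loewner_le n a b \<longleftrightarrow> a \<in> carrier_mat n n \<and> b \<in> carrier_mat n n \<and> b - a \<in> psd_cone n"

definition unitary_mat :: "nat \<Rightarrow> complex mat \<Rightarrow> bool" where
  "unitary_mat n u \<longleftrightarrow> u \<in> carrier_mat n n \<and>
     u * mat_adjoint u = 1\<^sub>m n \<and> mat_adjoint u * u = 1\<^sub>m n"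

text \<open>Eigenvalues in decreasing order, with multiplicity as roots of the characteristic polynomial.
  \<open>Re\<close> only changes the type: the roots are real for matrices in \<open>psd_cone n\<close>
  (lemma \<open>eigenvalues_decr_psd\<close> below).\<close>

definition eigenvalues_decr :: "complex mat \<Rightarrow> real list" where
  "eigenvalues_decr a = rev (sorted_list_of_multiset (image_mset Re (proots (char_poly a))))"

text \<open>The index \<open>i\<close> of \<open>eig i a\<close> starts at \<open>1\<close>, list positions start at \<open>0\<close>.\<close>

definition eig :: "nat \<Rightarrow> complex mat \<Rightarrow> real" where
  "eig i a = eigenvalues_decr a ! (i - 1)"

definition Phi :: "nat \<Rightarrow> (nat set \<Rightarrow> real) \<Rightarrow> complex mat \<Rightarrow> real" where
  "Phi n \<mu> a = (\<Sum>i = 1..n - 1. (eig i a - eig (i + 1) a) * \<mu> {1..i}) + eig n a * \<mu> {1..n}"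

definition positive_map :: "nat \<Rightarrow> (complex mat \<Rightarrow> real) \<Rightarrow> bool" where
  "positive_map n \<Phi> \<longleftrightarrow> (\<forall>a \<in> psd_cone n. 0 \<le> \<Phi> a)"

definition monotone_map :: "nat \<Rightarrow> (complex mat \<Rightarrow> real) \<Rightarrow> bool" where
  "monotone_map n \<Phi> \<longleftrightarrow> monotone_on (psd_cone n) (loewner_le n) (\<le>) \<Phi>"

definition unitarily_invariant :: "nat \<Rightarrow> (complex mat \<Rightarrow> real) \<Rightarrow> bool" where
  "unitarily_invariant n \<Phi> \<longleftrightarrow>
     (\<forall>a \<in> psd_cone n. \<forall>u. unitary_mat n u \<longrightarrow> \<Phi> (u * a * mat_adjoint u) = \<Phi> a)"

lemma sorted_eigenvalues_decr: "sorted_wrt (\<ge>) (eigenvalues_decr a)"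
  by (simp add: eigenvalues_decr_def sorted_wrt_rev)

lemma length_eigenvalues_decr:
  assumes "a \<in> carrier_mat n n"
  shows "length (eigenvalues_decr a) = n"
proof -
  have "length (eigenvalues_decr a) = size (mset (eigenvalues_decr a))" by simp
  also have "\<dots> = n"
    using assms degree_monic_char_poly[OF assms]
    by (simp add: eigenvalues_decr_def size_proots_complex del: size_mset)
  finally show ?thesis .
qed

lemma psd_eigenvalue_nonneg:
  assumes a: "a \<in> psd_cone n" and "eigenvalue a k"
  shows "0 \<le> k"
proof -
  have ac: "a \<in> carrier_mat n n" using a by (simp add: psd_cone_def)
  from \<open>eigenvalue a k\<close> obtain v where v: "v \<in> carrier_vec n" "v \<noteq> 0\<^sub>v n" "a *\<^sub>v v = k \<cdot>\<^sub>v v"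
    using ac by (auto simp: eigenvalue_def eigenvector_def)
  have "0 \<le> (a *\<^sub>v v) \<bullet>c v" using a v(1) by (simp add: psd_cone_def)
  also have "\<dots> = k * (v \<bullet>c v)" using v by simp
  finally have *: "0 \<le> k * (v \<bullet>c v)" .
  have "0 < v \<bullet>c v" using conjugate_square_greater_0_vec[OF v(1)] v by simp
  then show ?thesis using *
    by (auto simp: less_eq_complex_def less_complex_def zero_le_mult_iff)
qed

lemma eigenvalues_decr_psd:
  assumes a: "a \<in> psd_cone n"
  shows "mset (map complex_of_real (eigenvalues_decr a)) = proots (char_poly a)"
proof -
  have ac: "a \<in> carrier_mat n n" using a by (simp add: psd_cone_def)
  have nz: "char_poly a \<noteq> 0" using degree_monic_char_poly[OF ac] by auto
  have "complex_of_real (Re k) = k" if "k \<in># proots (char_poly a)" for k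
  proof -
    have "eigenvalue a k" using that nz eigenvalue_root_char_poly[OF ac] by simp
    from psd_eigenvalue_nonneg[OF a this] show ?thesis
      by (simp add: less_eq_complex_def complex_eq_iff)
  qed
  then have "image_mset (\<lambda>k. complex_of_real (Re k)) (proots (char_poly a)) =
      image_mset id (proots (char_poly a))"
    by (intro image_mset_cong) simp
  then show ?thesis by (simp add: eigenvalues_decr_def multiset.map_comp o_def)
qed

end

theory Submission
  imports Defs
begin

text \<open>Summation by parts writes \<open>\<Phi>\<^sub>\<mu>(a)\<close> as \<open>\<Sum>i. \<lambda>\<^sub>i(a) (\<mu>(A\<^sub>i) - \<mu>(A\<^sub>i\<^sub>-\<^sub>1))\<close> with nonnegative
  weights, so everything reduces to the single eigenvalues; the only real content is Weyl's monotonicity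
  \<open>\<lambda>\<^sub>i(a) \<le> \<lambda>\<^sub>i(b)\<close> for \<open>a \<le> b\<close>, which compares the two quadratic forms in orthogonal eigenbases.\<close>

section \<open>Hermitian symmetry, orthogonal complements and eigenvectors in invariant sets\<close>

lemma hermitian_cscalar_prod:
  fixes A :: "'a :: conjugatable_field mat"
  assumes A: "A \<in> carrier_mat n n" and h: "mat_adjoint A = A"
    and v: "v \<in> carrier_vec n" and w: "w \<in> carrier_vec n"
  shows "(A *\<^sub>v v) \<bullet>c w = v \<bullet>c (A *\<^sub>v w)"
proof -
  have ent: "conjugate (A $$ (i, j)) = A $$ (j, i)" if "i < n" "j < n" for i j
  proof -
    have "mat_adjoint A $$ (j, i) = conjugate (A $$ (i, j))"
      using that A by (simp add: mat_adjoint_def mat_of_rows_index)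
    then show ?thesis by (simp add: h)
  qed
  have "(A *\<^sub>v v) \<bullet>c w = (\<Sum>i<n. \<Sum>j<n. A $$ (i, j) * v $ j * conjugate (w $ i))"
    using A v w by (simp add: scalar_prod_def atLeast0LessThan sum_distrib_right)
  also have "\<dots> = (\<Sum>j<n. \<Sum>i<n. A $$ (i, j) * v $ j * conjugate (w $ i))"
    by (rule sum.swap)
  also have "\<dots> = v \<bullet>c (A *\<^sub>v w)"
    using A v w
    by (simp add: scalar_prod_def atLeast0LessThan sum_conjugate sum_distrib_left
        conjugate_dist_mul ent mult_ac)
  finally show ?thesis .
qed

text \<open>Fewer than \<open>n\<close> linear conditions on \<open>n\<close> unknowns have a
  nonzero common solution: the conjugated vectors, padded with zero rows to a square matrix, give a
  singular matrix, and any nonzero kernel vector will do.\<close>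

lemma exists_orthogonal_vec:
  fixes ws :: "'a :: conjugatable_field vec list"
  assumes ws: "set ws \<subseteq> carrier_vec n" and len: "length ws < n"
  obtains v where "v \<in> carrier_vec n" "v \<noteq> 0\<^sub>v n" "\<And>w. w \<in> set ws \<Longrightarrow> v \<bullet>c w = 0"
proof -
  define M where "M = mat_of_rows n (map conjugate ws @ replicate (n - length ws) (0\<^sub>v n))"
  have M: "M \<in> carrier_mat n n" using len by (simp add: M_def mat_of_rows_def)
  have row: "row M (length ws) = 0\<^sub>v n"
    using len ws by (intro eq_vecI) (auto simp: M_def mat_of_rows_index nth_append)
  have "det M = 0"
  proof -
    \<comment> \<open>Row \<open>length ws\<close> is the first padding row. Being zero, it is
      unchanged by scaling with 0, while that scaling multiplies the determinant by 0.\<close>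
    have "M = multrow (length ws) 0 M"
    proof (rule eq_matI)
      fix i j assume ij: "i < dim_row (multrow (length ws) 0 M)" "j < dim_col (multrow (length ws) 0 M)"
      have "M $$ (length ws, j) = row M (length ws) $ j" using ij M len by simp
      also have "\<dots> = 0" unfolding row using ij M by simp
      finally show "M $$ (i, j) = multrow (length ws) 0 M $$ (i, j)" using ij by auto
    qed (use M in auto)
    then show ?thesis using det_multrow[OF len M, of 0] by simp
  qed
  then obtain v where v: "v \<in> carrier_vec n" "v \<noteq> 0\<^sub>v n" "M *\<^sub>v v = 0\<^sub>v n"
    using det_0_iff_vec_prod_zero_field[OF M] by blast
  have "v \<bullet>c w = 0" if w: "w \<in> set ws" for w
  proof -
    obtain i where i: "i < length ws" "w = ws ! i" using w by (auto simp: in_set_conv_nth)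
    have wc: "w \<in> carrier_vec n" using w ws by auto
    have "row M i = conjugate w"
      using i len wc by (intro eq_vecI) (auto simp: M_def mat_of_rows_index nth_append)
    then have "conjugate w \<bullet> v = (M *\<^sub>v v) $ i" using i len M by simp
    also have "\<dots> = 0" using v(3) i len by simp
    finally show ?thesis using wc v(1) by (simp add: conjugate_vec_sprod_comm)
  qed
  with v that show ?thesis by blast
qed

text \<open>In Schur coordinates, subtracting the \<open>m\<close>-th diagonal entry kills the last remaining coordinate; the
  last nonzero vector reached this way is an eigenvector.\<close>

lemma eigenvector_in_invariant_set:
  fixes A :: "complex mat"
  assumes A: "A \<in> carrier_mat n n" and K: "K \<subseteq> carrier_vec n"
    and inv: "\<And>v c. v \<in> K \<Longrightarrow> A *\<^sub>v v - c \<cdot>\<^sub>v v \<in> K"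
    and w: "w \<in> K" "w \<noteq> 0\<^sub>v n"
  obtains u e where "u \<in> K" "u \<noteq> 0\<^sub>v n" "A *\<^sub>v u = e \<cdot>\<^sub>v u"
proof -
  have "smult (lead_coeff (char_poly A)) (\<Prod>x\<in>#proots (char_poly A). [:- x, 1:]) = char_poly A"
    by (rule complex_poly_decompose_multiset)
  moreover obtain es where "mset es = proots (char_poly A)" using ex_mset by blast
  ultimately have "char_poly A = (\<Prod>e\<leftarrow>es. [:- e, 1:])"
    using degree_monic_char_poly[OF A] by (simp flip: prod_mset_prod_list)
  from schur_decomposition_exists[OF A this] obtain B P Q
    where sim: "similar_mat_wit A B P Q" and tri: "upper_triangular B"
    unfolding similar_mat_def by blast
  have n: "n = dim_row A" using A by simp
  note PQ = similar_mat_witD[OF n sim]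
  have "\<exists>u\<in>K. u \<noteq> 0\<^sub>v n \<and> (\<exists>e. A *\<^sub>v u = e \<cdot>\<^sub>v u)"
    if "v \<in> K" "v \<noteq> 0\<^sub>v n" "\<And>i. m \<le> i \<Longrightarrow> i < n \<Longrightarrow> (Q *\<^sub>v v) $ i = 0" "m \<le> n" for v m
    using that
  proof (induction m arbitrary: v)
    case 0
    have v: "v \<in> carrier_vec n" using 0 K by auto
    have "Q *\<^sub>v v = 0\<^sub>v n" using 0 PQ by (intro eq_vecI) auto
    then have "P *\<^sub>v (Q *\<^sub>v v) = 0\<^sub>v n" using PQ by auto
    then have "v = 0\<^sub>v n" using PQ v by (simp flip: assoc_mult_mat_vec)
    with 0 show ?case by simp
  next
    case (Suc m)
    have v: "v \<in> carrier_vec n" using Suc K by auto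
    define c where "c = B $$ (m, m)"
    define v' where "v' = A *\<^sub>v v - c \<cdot>\<^sub>v v"
    have v'K: "v' \<in> K" unfolding v'_def by (rule inv) fact
    show ?case
    proof (cases "v' = 0\<^sub>v n")
      case True
      have "(A *\<^sub>v v) $ i = (c \<cdot>\<^sub>v v) $ i" if "i < n" for i
        using arg_cong[OF True, of "\<lambda>v. v $ i"] that v A by (simp add: v'_def)
      then have "A *\<^sub>v v = c \<cdot>\<^sub>v v" using v A by (intro eq_vecI) auto
      with Suc.prems show ?thesis by blast
    next
      case False
      \<comment> \<open>\<open>Q\<close> intertwines \<open>A\<close> with \<open>B\<close>, since
        \<open>A = P * B * Q\<close> and \<open>Q * P\<close> is the identity.\<close>
      have "Q *\<^sub>v (A *\<^sub>v v) = (Q * (P * (B * Q))) *\<^sub>v v"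
        unfolding assoc_mult_mat_vec[OF PQ(7,4) v, symmetric]
        using PQ by (simp add: assoc_mult_mat[of _ n n _ n _ n])
      also have "Q * (P * (B * Q)) = (Q * P) * (B * Q)"
        using PQ by (intro assoc_mult_mat[symmetric]) auto
      also have "\<dots> *\<^sub>v v = B *\<^sub>v (Q *\<^sub>v v)"
        using PQ(2) assoc_mult_mat_vec[OF PQ(5,7) v] left_mult_one_mat[OF mult_carrier_mat[OF PQ(5,7)]]
        by simp
      finally have QA: "Q *\<^sub>v (A *\<^sub>v v) = B *\<^sub>v (Q *\<^sub>v v)" .
      have Qv': "Q *\<^sub>v v' = B *\<^sub>v (Q *\<^sub>v v) - c \<cdot>\<^sub>v (Q *\<^sub>v v)"
        unfolding v'_def QA[symmetric] mult_mat_vec[OF PQ(7) v, symmetric]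
        using PQ(4,7) v by (intro mult_minus_distrib_mat_vec) auto
      have "(Q *\<^sub>v v') $ i = 0" if i: "m \<le> i" "i < n" for i
      proof -
        have "(B *\<^sub>v (Q *\<^sub>v v)) $ i = (\<Sum>k<n. B $$ (i, k) * (Q *\<^sub>v v) $ k)"
          using PQ v i by (simp add: scalar_prod_def atLeast0LessThan)
        \<comment> \<open>Entries left of the diagonal vanish by triangularity, and coordinates of
          \<open>Q *\<^sub>v v\<close> beyond \<open>m\<close> vanish by hypothesis. Only
          \<open>k = i\<close> survives; for \<open>i = m\<close> its coefficient is
          \<open>c\<close>, and for \<open>i > m\<close> the coordinate is 0, so that writing
          \<open>c\<close> there is harmless.\<close>
        also have "\<dots> = (\<Sum>k<n. if k = i then c * (Q *\<^sub>v v) $ i else 0)"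
        proof (rule sum.cong)
          fix k assume k: "k \<in> {..<n}"
          show "B $$ (i, k) * (Q *\<^sub>v v) $ k = (if k = i then c * (Q *\<^sub>v v) $ i else 0)"
          proof (cases "k < i")
            case True
            then have "B $$ (i, k) = 0" using tri PQ i by (intro upper_triangularD) auto
            then show ?thesis using True by simp
          next
            case False
            then show ?thesis using Suc.prems(3)[of k] i k
              by (cases "k = m") (auto simp: c_def simp del: index_mult_mat_vec)
          qed
        qed simp
        also have "\<dots> = c * (Q *\<^sub>v v) $ i" using i by simp
        finally show ?thesis using Qv' PQ v i by simp
      qed
      then show ?thesis using Suc.IH[OF v'K False] Suc.prems by simp
    qed
  qed
  from this[OF w, of n] that show ?thesis by auto
qed

section \<open>Spectral theorem: orthogonal eigenbases with real eigenvalues\<close>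

text \<open>The vectors are nonzero, because \<open>corthogonal\<close> also forbids a vanishing
  product of a vector with itself, but they are not normalised. Their squared norms therefore enter
  the weights of the quadratic form. The order of \<open>es\<close> is left open and stated
  separately.\<close>

definition orthogonal_eigenbasis :: "nat \<Rightarrow> complex mat \<Rightarrow> complex vec list \<Rightarrow> real list \<Rightarrow> bool" where
  "orthogonal_eigenbasis n A vs es \<longleftrightarrow>
     set vs \<subseteq> carrier_vec n \<and> length vs = n \<and> corthogonal vs \<and> length es = n \<and>
     (\<forall>i<n. A *\<^sub>v vs ! i = complex_of_real (es ! i) \<cdot>\<^sub>v vs ! i)"

lemma cscalar_prod_commute:
  fixes v w :: "'a :: {conjugatable_ring, comm_ring} vec"
  assumes "v \<in> carrier_vec n" "w \<in> carrier_vec n"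
  shows "v \<bullet>c w = conjugate (w \<bullet>c v)"
  using assms conjugate_conjugate_sprod[of v n w] conjugate_vec_sprod_comm[of w n v] by simp

lemma cscalar_prod_smult_right:
  fixes v w :: "'a :: {conjugatable_ring, comm_ring} vec"
  assumes "v \<in> carrier_vec n" "w \<in> carrier_vec n"
  shows "v \<bullet>c (k \<cdot>\<^sub>v w) = conjugate k * (v \<bullet>c w)"
  using assms by (simp add: conjugate_smult_vec)

lemma corthogonal_Cons:
  fixes u :: "'a :: {conjugatable_ring, comm_ring} vec"
  assumes vs: "corthogonal vs" "set vs \<subseteq> carrier_vec n"
    and u: "u \<in> carrier_vec n" "u \<bullet>c u \<noteq> 0" "\<And>v. v \<in> set vs \<Longrightarrow> u \<bullet>c v = 0"
  shows "corthogonal (u # vs)"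
proof (rule corthogonalI)
  have v: "v \<bullet>c u = 0" if "v \<in> set vs" for v
    using that vs(2) u cscalar_prod_commute[of v n u] by auto
  fix i j assume "i < length (u # vs)" "j < length (u # vs)"
  then show "((u # vs) ! i \<bullet>c (u # vs) ! j = 0) = (i \<noteq> j)"
    using corthogonalD[OF vs(1), of "i - 1" "j - 1"] u v by (cases i; cases j) auto
qed

text \<open>The eigenvectors are found one at a time. As long as there are fewer than
  \<open>n\<close>, their orthogonal complement is nonzero, and Hermitian symmetry makes it
  invariant, so it contains a further eigenvector.\<close>

lemma hermitian_orthogonal_eigenvectors:
  fixes A :: "complex mat"
  assumes A: "A \<in> carrier_mat n n" and h: "mat_adjoint A = A"
  shows "\<exists>vs. set vs \<subseteq> carrier_vec n \<and> length vs = n \<and> corthogonal vs \<and>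
    (\<forall>v\<in>set vs. \<exists>e. A *\<^sub>v v = e \<cdot>\<^sub>v v)"
proof -
  have "\<exists>vs. set vs \<subseteq> carrier_vec n \<and> length vs = m \<and> corthogonal vs \<and>
    (\<forall>v\<in>set vs. \<exists>e. A *\<^sub>v v = e \<cdot>\<^sub>v v)" if "m \<le> n" for m
    using that
  proof (induction m)
    case 0
    show ?case by (intro exI[of _ "[]"]) auto
  next
    case (Suc m)
    then obtain vs where vs: "set vs \<subseteq> carrier_vec n" "length vs = m" "corthogonal vs"
      and ev: "\<And>v. v \<in> set vs \<Longrightarrow> \<exists>e. A *\<^sub>v v = e \<cdot>\<^sub>v v" by auto
    define K where "K = {v \<in> carrier_vec n. \<forall>w\<in>set vs. v \<bullet>c w = 0}"
    have "length vs < n" using vs(2) Suc.prems by simp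
    from exists_orthogonal_vec[OF vs(1) this]
    obtain w where w': "w \<in> carrier_vec n" "w \<noteq> 0\<^sub>v n" "\<And>v. v \<in> set vs \<Longrightarrow> w \<bullet>c v = 0"
      by blast
    then have w: "w \<in> K" by (simp add: K_def)
    have inv: "A *\<^sub>v v - c \<cdot>\<^sub>v v \<in> K" if v: "v \<in> K" for v c
    proof -
      have vc: "v \<in> carrier_vec n" using v by (simp add: K_def)
      have "(A *\<^sub>v v - c \<cdot>\<^sub>v v) \<bullet>c w = 0" if w: "w \<in> set vs" for w
      proof -
        have wc: "w \<in> carrier_vec n" using w vs by auto
        obtain e where e: "A *\<^sub>v w = e \<cdot>\<^sub>v w" using ev[OF w] by blast
        have vw: "v \<bullet>c w = 0" using v w by (simp add: K_def)
        \<comment> \<open>Moving \<open>A\<close> to the eigenvector \<open>w\<close> only produces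
          a scalar multiple of \<open>v \<bullet>c w\<close>, which is 0.\<close>
        have "(A *\<^sub>v v) \<bullet>c w = 0"
          using hermitian_cscalar_prod[OF A h vc wc] cscalar_prod_smult_right[OF vc wc] vw by (simp add: e)
        then show ?thesis
          using A vc wc vw by (simp add: minus_scalar_prod_distrib[of _ n])
      qed
      then show ?thesis using A vc by (simp add: K_def)
    qed
    obtain u e where u: "u \<in> K" "u \<noteq> 0\<^sub>v n" "A *\<^sub>v u = e \<cdot>\<^sub>v u"
      using eigenvector_in_invariant_set[OF A _ inv w w'(2)] by (auto simp: K_def)
    have "corthogonal (u # vs)"
      using u vs by (intro corthogonal_Cons[of _ n]) (auto simp: K_def)
    then show ?case using u vs ev by (intro exI[of _ "u # vs"]) (auto simp: K_def)
  qed
  then show ?thesis by blast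
qed

text \<open>Moving \<open>A\<close> across the product \<open>v \<bullet>c v\<close> replaces
  \<open>e\<close> by its conjugate, and the product itself can be cancelled.\<close>

lemma hermitian_eigenvalue_real:
  fixes A :: "complex mat"
  assumes A: "A \<in> carrier_mat n n" and h: "mat_adjoint A = A"
    and v: "v \<in> carrier_vec n" "v \<noteq> 0\<^sub>v n" and e: "A *\<^sub>v v = e \<cdot>\<^sub>v v"
  shows "complex_of_real (Re e) = e"
proof -
  have "e * (v \<bullet>c v) = cnj e * (v \<bullet>c v)"
    using hermitian_cscalar_prod[OF A h v(1) v(1)] v(1) cscalar_prod_smult_right[OF v(1) v(1)]
    by (simp add: e)
  moreover have "v \<bullet>c v \<noteq> 0" using v by simp
  ultimately have "cnj e = e" by simp
  then show ?thesis by (simp add: complex_eq_iff)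
qed

lemma hermitian_orthogonal_eigenbasis:
  assumes A: "A \<in> carrier_mat n n" and h: "mat_adjoint A = A"
  obtains vs es where "orthogonal_eigenbasis n A vs es" "sorted_wrt (\<ge>) es"
proof -
  obtain us where us: "set us \<subseteq> carrier_vec n" "length us = n" "corthogonal us"
    and "\<forall>v\<in>set us. \<exists>e. A *\<^sub>v v = e \<cdot>\<^sub>v v"
    using hermitian_orthogonal_eigenvectors[OF A h] by blast
  then obtain e where e: "\<And>v. v \<in> set us \<Longrightarrow> A *\<^sub>v v = e v \<cdot>\<^sub>v v" by metis
  have nz: "v \<noteq> 0\<^sub>v n" if v: "v \<in> set us" for v
  proof -
    obtain i where "i < length us" "v = us ! i" using v by (auto simp: in_set_conv_nth)
    then have "v \<bullet>c v \<noteq> 0" using corthogonalD[OF us(3), of i i] by simp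
    then show ?thesis by auto
  qed
  \<comment> \<open>The negated key makes the increasing sort list the eigenvalues in decreasing
    order; permuting the vectors preserves orthogonality.\<close>
  define vs where "vs = sort_key (\<lambda>v. - Re (e v)) us"
  have "corthogonal vs"
    using corthogonal_sort[of vs us] us(3) corthogonal_distinct[OF us(3)] by (simp add: vs_def)
  moreover have "A *\<^sub>v v = complex_of_real (Re (e v)) \<cdot>\<^sub>v v" if "v \<in> set vs" for v
    using that us(1) e[of v] nz[of v] hermitian_eigenvalue_real[OF A h, of v "e v"] by (auto simp: vs_def)
  ultimately have "orthogonal_eigenbasis n A vs (map (\<lambda>v. Re (e v)) vs)"
    using us nth_mem[of _ vs] unfolding orthogonal_eigenbasis_def by (auto simp: vs_def)
  moreover have "sorted_wrt (\<ge>) (map (\<lambda>v. Re (e v)) vs)"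
    using sorted_sort_key[of "\<lambda>v. - Re (e v)" us] by (simp add: vs_def sorted_wrt_map)
  ultimately show ?thesis using that by blast
qed

section \<open>Identifying the decreasing eigenvalue list\<close>

text \<open>With the eigenvectors as columns of \<open>P\<close>, the eigenvalue equations read
  \<open>A * P = P * D\<close>. Orthogonality of the columns supplies the inverse of
  \<open>P\<close>: its adjoint with rows rescaled by the squared norms.\<close>

lemma orthogonal_eigenbasis_similar:
  assumes A: "A \<in> carrier_mat n n" and b: "orthogonal_eigenbasis n A vs es"
  obtains Q where "similar_mat_wit A (mat_diag n (\<lambda>i. complex_of_real (es ! i))) (mat_of_cols n vs) Q"
proof -
  let ?P = "mat_of_cols n vs" and ?D = "mat_diag n (\<lambda>i. complex_of_real (es ! i))"
  define Q where "Q = corthogonal_inv ?P"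
  note b' = b[unfolded orthogonal_eigenbasis_def]
  have len: "length vs = n" using b' by simp
  have P: "?P \<in> carrier_mat n n" using len by auto
  have Q: "Q \<in> carrier_mat n n" using P b' by (simp add: Q_def corthogonal_inv_def mat_of_rows_def)
  have "inverts_mat Q ?P"
    unfolding Q_def using b' by (intro corthogonal_inv_result orthogonal_mat_of_cols) auto
  then have QP: "Q * ?P = 1\<^sub>m n" using Q by (simp add: inverts_mat_def)
  have PQ: "?P * Q = 1\<^sub>m n" by (rule mat_mult_left_right_inverse[OF Q P QP])
  have D: "?D \<in> carrier_mat n n" by simp
  have "A * ?P = ?P * ?D"
  proof (rule eq_matI)
    fix i j assume ij: "i < dim_row (?P * ?D)" "j < dim_col (?P * ?D)"
    then have ij: "i < n" "j < n" using P by (auto simp: mat_diag_def)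
    have vj: "vs ! j \<in> carrier_vec n" using b' ij by auto
    have "(A * ?P) $$ (i, j) = (A *\<^sub>v vs ! j) $ i"
      using A P ij vj len by simp
    also have "A *\<^sub>v vs ! j = complex_of_real (es ! j) \<cdot>\<^sub>v vs ! j" using b' ij by blast
    also have "\<dots> $ i = complex_of_real (es ! j) * vs ! j $ i" using ij vj by simp
    also have "\<dots> = (?P * ?D) $$ (i, j)"
      using P ij vj b' by (simp add: mat_diag_mult_right[OF P] mat_of_cols_index)
    finally show "(A * ?P) $$ (i, j) = (?P * ?D) $$ (i, j)" .
  qed (use A P carrier_matD[OF D] len in auto)
  then have "?P * ?D * Q = A * ?P * Q" by simp
  also have "\<dots> = A * (?P * Q)" by (rule assoc_mult_mat[OF A P Q])
  also have "\<dots> = A" using A by (simp add: PQ)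
  finally have "similar_mat_wit A ?D ?P Q"
    using A D P Q PQ QP by (intro similar_mat_witI[of _ _ n]) (simp_all only:)
  then show ?thesis by (rule that)
qed

text \<open>Similarity to the diagonal matrix factors the characteristic polynomial, so any
  orthogonal eigenbasis carries the eigenvalues with the right multiplicities, and sorting fixes
  their order. This allows eigenvalue lists to be computed by exhibiting an eigenbasis.\<close>

lemma eigenvalues_decr_eqI:
  assumes A: "A \<in> carrier_mat n n" and b: "orthogonal_eigenbasis n A vs es"
    and s: "sorted_wrt (\<ge>) es"
  shows "eigenvalues_decr A = es"
proof -
  let ?D = "mat_diag n (\<lambda>i. complex_of_real (es ! i))"
  have len: "length es = n" using b by (simp add: orthogonal_eigenbasis_def)
  have D: "?D \<in> carrier_mat n n" by simp
  have "similar_mat A ?D"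
    using orthogonal_eigenbasis_similar[OF A b] unfolding similar_mat_def by blast
  then have "char_poly A = char_poly ?D" by (rule char_poly_similar)
  also have "\<dots> = (\<Prod>a\<leftarrow>diag_mat ?D. [:- a, 1:])"
    by (rule char_poly_upper_triangular[OF D]) (auto simp: upper_triangular_def mat_diag_def)
  also have "diag_mat ?D = map complex_of_real es"
    using len by (intro nth_equalityI) (auto simp: diag_mat_def mat_diag_def)
  finally have cp: "char_poly A = (\<Prod>a\<leftarrow>map complex_of_real es. [:- a, 1:])" .
  have "proots (\<Prod>a\<leftarrow>xs. [:- a, 1:]) = mset xs" for xs :: "complex list"
  proof (induction xs)
    case (Cons x xs)
    have "(\<Prod>a\<leftarrow>xs. [:- a, 1:]) \<noteq> 0" by auto
    then have "proots ([:- x, 1:] * (\<Prod>a\<leftarrow>xs. [:- a, 1:])) = {#x#} + mset xs"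
      using Cons by (subst proots_mult) auto
    then show ?case by simp
  qed simp
  then have "image_mset Re (proots (char_poly A)) = image_mset Re (mset (map complex_of_real es))"
    unfolding cp by (rule arg_cong)
  also have "\<dots> = mset es" by (simp add: multiset.map_comp o_def)
  finally have "image_mset Re (proots (char_poly A)) = mset es" .
  \<comment> \<open>\<open>eigenvalues_decr\<close> reverses an increasing list, hence the
    increasing arrangement of \<open>es\<close> is needed.\<close>
  moreover have "sort es = rev es"
    using s by (intro properties_for_sort) (simp_all add: sorted_wrt_rev)
  ultimately show ?thesis
    by (simp add: eigenvalues_decr_def)
qed

lemma eigenvalues_decr_eigenbasis:
  assumes A: "A \<in> carrier_mat n n" and h: "mat_adjoint A = A"
  obtains vs where "orthogonal_eigenbasis n A vs (eigenvalues_decr A)"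
proof -
  obtain vs es where "orthogonal_eigenbasis n A vs es" "sorted_wrt (\<ge>) es"
    using hermitian_orthogonal_eigenbasis[OF A h] .
  with eigenvalues_decr_eqI[OF A] that show ?thesis by blast
qed

section \<open>The quadratic form in eigencoordinates and Weyl's monotonicity\<close>

text \<open>The matrix-vector product is the linear combination of \<open>vs\<close> with
  coefficients \<open>x\<close>, and the product is conjugate linear in its second argument.\<close>

lemma cscalar_prod_mat_of_cols:
  fixes vs :: "'a :: conjugatable_field vec list"
  assumes vs: "set vs \<subseteq> carrier_vec n" "length vs = n"
    and x: "x \<in> carrier_vec n" and y: "y \<in> carrier_vec n"
  shows "y \<bullet>c (mat_of_cols n vs *\<^sub>v x) = (\<Sum>i<n. conjugate (x $ i) * (y \<bullet>c vs ! i))"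
proof -
  have "y \<bullet>c (mat_of_cols n vs *\<^sub>v x) =
      (\<Sum>k<n. \<Sum>i<n. conjugate (x $ i) * (y $ k * conjugate (vs ! i $ k)))"
    using assms
    by (simp add: scalar_prod_def atLeast0LessThan sum_conjugate sum_distrib_left
        conjugate_dist_mul mult_ac mat_of_cols_index)
  also have "\<dots> = (\<Sum>i<n. \<Sum>k<n. conjugate (x $ i) * (y $ k * conjugate (vs ! i $ k)))"
    by (rule sum.swap)
  also have "\<dots> = (\<Sum>i<n. conjugate (x $ i) * (y \<bullet>c vs ! i))"
  proof (rule sum.cong)
    fix i assume "i \<in> {..<n}"
    then have "vs ! i \<in> carrier_vec n" using vs by auto
    then show "(\<Sum>k<n. conjugate (x $ i) * (y $ k * conjugate (vs ! i $ k))) =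
        conjugate (x $ i) * (y \<bullet>c vs ! i)"
      by (simp add: scalar_prod_def atLeast0LessThan sum_distrib_left)
  qed simp
  finally show ?thesis .
qed

text \<open>In eigencoordinates the form is diagonal, and \<open>c i\<close> is the squared norm of
  the component of \<open>v\<close> along the \<open>i\<close>-th eigenvector. The existential hides
  the coordinates and keeps only what a comparison of two forms in different bases requires.\<close>

lemma quadratic_form_eigenbasis:
  assumes A: "A \<in> carrier_mat n n" and h: "mat_adjoint A = A"
    and b: "orthogonal_eigenbasis n A vs es" and v: "v \<in> carrier_vec n"
  shows "\<exists>c. (\<forall>i<n. 0 \<le> c i) \<and> (\<forall>i<n. v \<bullet>c vs ! i = 0 \<longrightarrow> c i = 0) \<and>
    v \<bullet>c v = complex_of_real (\<Sum>i<n. c i) \<and>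
    (A *\<^sub>v v) \<bullet>c v = complex_of_real (\<Sum>i<n. es ! i * c i)"
proof -
  note b' = b[unfolded orthogonal_eigenbasis_def]
  have vs: "set vs \<subseteq> carrier_vec n" "length vs = n" and orth: "corthogonal vs" using b' by auto
  have vi: "vs ! i \<in> carrier_vec n" if "i < n" for i using vs that by auto
  obtain Q where sim: "similar_mat_wit A (mat_diag n (\<lambda>i. complex_of_real (es ! i))) (mat_of_cols n vs) Q"
    using orthogonal_eigenbasis_similar[OF A b] .
  have "n = dim_row A" using A by simp
  note PQ = similar_mat_witD[OF this sim]
  define x where "x = Q *\<^sub>v v"
  have x: "x \<in> carrier_vec n" using PQ v by (simp add: x_def)
  have Px: "v = mat_of_cols n vs *\<^sub>v x"
    unfolding x_def using assoc_mult_mat_vec[OF PQ(6,7) v] PQ(1) v by simp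
  \<comment> \<open>The factor \<open>vs ! i \<bullet>c vs ! i\<close> compensates for the missing
    normalisation.\<close>
  define c where "c i = (cmod (x $ i))\<^sup>2 * Re (vs ! i \<bullet>c vs ! i)" for i
  have coeff: "vs ! i \<bullet>c v = cnj (x $ i) * (vs ! i \<bullet>c vs ! i)" if i: "i < n" for i
  proof -
    have "vs ! i \<bullet>c v = (\<Sum>j<n. cnj (x $ j) * (vs ! i \<bullet>c vs ! j))"
      unfolding Px using cscalar_prod_mat_of_cols[OF vs x vi[OF i]] by simp
    also have "\<dots> = (\<Sum>j<n. if j = i then cnj (x $ i) * (vs ! i \<bullet>c vs ! i) else 0)"
      using corthogonalD[OF orth] i vs by (intro sum.cong) auto
    finally show ?thesis using i by simp
  qed
  \<comment> \<open>These are the terms obtained by expanding the second argument of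
    \<open>v \<bullet>c v\<close> in the eigenbasis.\<close>
  have c: "cnj (x $ i) * (v \<bullet>c vs ! i) = complex_of_real (c i)" and c0: "0 \<le> c i"
    if i: "i < n" for i
  proof -
    have ge: "0 \<le> vs ! i \<bullet>c vs ! i" by (rule conjugate_square_ge_0_vec)
    then have re: "vs ! i \<bullet>c vs ! i = complex_of_real (Re (vs ! i \<bullet>c vs ! i))"
      by (simp add: less_eq_complex_def complex_eq_iff)
    have "v \<bullet>c vs ! i = cnj (vs ! i \<bullet>c v)"
      using cscalar_prod_commute[OF v vi[OF i]] by simp
    also have "\<dots> = x $ i * complex_of_real (Re (vs ! i \<bullet>c vs ! i))"
      unfolding coeff[OF i] by (subst re) simp
    finally have "cnj (x $ i) * (v \<bullet>c vs ! i) =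
        (x $ i * cnj (x $ i)) * complex_of_real (Re (vs ! i \<bullet>c vs ! i))" by simp
    then show "cnj (x $ i) * (v \<bullet>c vs ! i) = complex_of_real (c i)"
      by (simp only: c_def complex_norm_square of_real_mult)
    show "0 \<le> c i" using ge by (simp add: c_def less_eq_complex_def)
  qed
  show ?thesis
  proof (intro exI[of _ c] conjI allI impI)
    show "0 \<le> c i" if "i < n" for i using c0[OF that] .
    show "c i = 0" if "i < n" "v \<bullet>c vs ! i = 0" for i using c[OF that(1)] that(2) by simp
    have "v \<bullet>c v = (\<Sum>i<n. cnj (x $ i) * (v \<bullet>c vs ! i))"
      using cscalar_prod_mat_of_cols[OF vs x v] by (simp flip: Px)
    then show "v \<bullet>c v = complex_of_real (\<Sum>i<n. c i)" using c by simp
    \<comment> \<open>Only the second argument is expanded; Hermitian symmetry then turns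
      \<open>A\<close> into the factor \<open>es ! i\<close> in each term.\<close>
    have "(A *\<^sub>v v) \<bullet>c v = (\<Sum>i<n. cnj (x $ i) * ((A *\<^sub>v v) \<bullet>c vs ! i))"
      using cscalar_prod_mat_of_cols[OF vs x mult_mat_vec_carrier[OF A v]]
      by (simp flip: Px)
    also have "\<dots> = (\<Sum>i<n. complex_of_real (es ! i) * complex_of_real (c i))"
    proof (rule sum.cong)
      fix i assume "i \<in> {..<n}"
      then have i: "i < n" by simp
      have "(A *\<^sub>v v) \<bullet>c vs ! i = complex_of_real (es ! i) * (v \<bullet>c vs ! i)"
        using hermitian_cscalar_prod[OF A h v vi[OF i]] b' i
          cscalar_prod_smult_right[OF v vi[OF i]] by simp
      then show "cnj (x $ i) * ((A *\<^sub>v v) \<bullet>c vs ! i) = complex_of_real (es ! i) * complex_of_real (c i)"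
        by (simp flip: c[OF i])
    qed simp
    finally show "(A *\<^sub>v v) \<bullet>c v = complex_of_real (\<Sum>i<n. es ! i * c i)" by simp
  qed
qed

lemma psd_coneD:
  assumes "a \<in> psd_cone n"
  shows "a \<in> carrier_mat n n" "mat_adjoint a = a" "\<And>v. v \<in> carrier_vec n \<Longrightarrow> 0 \<le> (a *\<^sub>v v) \<bullet>c v"
  using assms by (auto simp: psd_cone_def)

text \<open>Test both forms on a nonzero vector orthogonal to the first \<open>k\<close> eigenvectors of \<open>b\<close> and to the last
  \<open>n - 1 - k\<close> eigenvectors of \<open>a\<close>.\<close>

lemma eigenvalues_decr_mono:
  assumes a: "a \<in> carrier_mat n n" "mat_adjoint a = a"
    and b: "b \<in> carrier_mat n n" "mat_adjoint b = b"
    and le: "loewner_le n a b" and k: "k < n"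
  shows "eigenvalues_decr a ! k \<le> eigenvalues_decr b ! k"
proof -
  define l m where "l = eigenvalues_decr a" and "m = eigenvalues_decr b"
  obtain us where us: "orthogonal_eigenbasis n a us l"
    using eigenvalues_decr_eigenbasis[OF a] by (auto simp: l_def)
  obtain ws where ws: "orthogonal_eigenbasis n b ws m"
    using eigenvalues_decr_eigenbasis[OF b] by (auto simp: m_def)
  have l: "l ! j \<le> l ! i" and m: "m ! j \<le> m ! i" if "i \<le> j" "j < n" for i j
    using that sorted_wrt_nth_less[OF sorted_eigenvalues_decr, of i j a]
      sorted_wrt_nth_less[OF sorted_eigenvalues_decr, of i j b]
      length_eigenvalues_decr[OF a(1)] length_eigenvalues_decr[OF b(1)]
    by (cases "i = j"; simp add: l_def m_def)+
  have sets: "set us \<subseteq> carrier_vec n" "length us = n" "set ws \<subseteq> carrier_vec n" "length ws = n"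
    using us ws by (auto simp: orthogonal_eigenbasis_def)
  let ?zs = "take k ws @ drop (Suc k) us"
  have zs: "set ?zs \<subseteq> carrier_vec n"
    using sets set_take_subset[of k ws] set_drop_subset[of "Suc k" us] by auto
  \<comment> \<open>There are \<open>k + (n - 1 - k) = n - 1\<close> conditions, one fewer than the
    dimension.\<close>
  have "length ?zs < n" using sets k by simp
  from exists_orthogonal_vec[OF zs this] obtain v where v: "v \<in> carrier_vec n" "v \<noteq> 0\<^sub>v n"
    and z: "\<And>z. z \<in> set ?zs \<Longrightarrow> v \<bullet>c z = 0"
    by blast
  have vw: "v \<bullet>c ws ! i = 0" if "i < k" for i
    using that k sets z[of "ws ! i"] nth_mem[of i "take k ws"] by simp
  have vu: "v \<bullet>c us ! i = 0" if "k < i" "i < n" for i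
    using that k sets z[of "us ! i"] nth_mem[of "i - Suc k" "drop (Suc k) us"] by simp
  obtain c where c: "\<And>i. i < n \<Longrightarrow> 0 \<le> c i" "\<And>i. i < n \<Longrightarrow> v \<bullet>c us ! i = 0 \<Longrightarrow> c i = 0"
    "v \<bullet>c v = complex_of_real (\<Sum>i<n. c i)"
    "(a *\<^sub>v v) \<bullet>c v = complex_of_real (\<Sum>i<n. l ! i * c i)"
    using quadratic_form_eigenbasis[OF a us v(1)] by blast
  obtain d where d: "\<And>i. i < n \<Longrightarrow> 0 \<le> d i" "\<And>i. i < n \<Longrightarrow> v \<bullet>c ws ! i = 0 \<Longrightarrow> d i = 0"
    "v \<bullet>c v = complex_of_real (\<Sum>i<n. d i)"
    "(b *\<^sub>v v) \<bullet>c v = complex_of_real (\<Sum>i<n. m ! i * d i)"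
    using quadratic_form_eigenbasis[OF b ws v(1)] by blast
  \<comment> \<open>The squared norm of \<open>v\<close> is the total of both families of weights,
    so the two spectral averages can be compared.\<close>
  define s where "s = (\<Sum>i<n. c i)"
  have sd: "s = (\<Sum>i<n. d i)" using c(3) d(3) by (simp add: s_def flip: of_real_sum)
  have "0 < v \<bullet>c v" using conjugate_square_greater_0_vec[OF v(1)] v by simp
  then have s: "0 < s" by (simp add: c(3) s_def less_complex_def)
  \<comment> \<open>The weights \<open>c i\<close> with \<open>i > k\<close> vanish, and the
    remaining eigenvalues of \<open>a\<close> are at least \<open>l ! k\<close>.\<close>
  have "l ! k * s \<le> (\<Sum>i<n. l ! i * c i)"
    unfolding s_def sum_distrib_left
  proof (rule sum_mono)
    fix i assume "i \<in> {..<n}"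
    then show "l ! k * c i \<le> l ! i * c i"
      using l[of i k] k c(1)[of i] c(2)[of i] vu[of i] by (cases "i \<le> k") (auto intro: mult_right_mono)
  qed
  also have "\<dots> \<le> (\<Sum>i<n. m ! i * d i)"
  proof -
    have "0 \<le> ((b - a) *\<^sub>v v) \<bullet>c v" using le v by (simp add: loewner_le_def psd_cone_def)
    also have "(b - a) *\<^sub>v v = b *\<^sub>v v - a *\<^sub>v v" using a b v by (simp add: minus_mult_distrib_mat_vec)
    also have "\<dots> \<bullet>c v = (b *\<^sub>v v) \<bullet>c v - (a *\<^sub>v v) \<bullet>c v"
      using a b v by (simp add: minus_scalar_prod_distrib[of _ n])
    finally show ?thesis by (simp add: c(4) d(4) less_eq_complex_def)
  qed
  \<comment> \<open>Here the weights \<open>d i\<close> with \<open>i < k\<close> vanish, and the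
    remaining eigenvalues of \<open>b\<close> are at most \<open>m ! k\<close>.\<close>
  also have "\<dots> \<le> m ! k * s"
    unfolding sd sum_distrib_left
  proof (rule sum_mono)
    fix i assume "i \<in> {..<n}"
    then show "m ! i * d i \<le> m ! k * d i"
      using m[of k i] k d(1)[of i] d(2)[of i] vw[of i] by (cases "k \<le> i") (auto intro: mult_right_mono)
  qed
  finally show ?thesis using s by (simp add: l_def m_def)
qed

section \<open>Scaling, unitary conjugation and nonnegativity of eigenvalues\<close>

text \<open>The same eigenbasis serves for the scaled matrix, and a nonnegative factor keeps the
  list decreasing.\<close>

lemma eigenvalues_decr_smult:
  assumes a: "a \<in> carrier_mat n n" "mat_adjoint a = a" and \<alpha>: "0 \<le> \<alpha>"
  shows "eigenvalues_decr (complex_of_real \<alpha> \<cdot>\<^sub>m a) = map ((*) \<alpha>) (eigenvalues_decr a)"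
proof -
  obtain vs where vs: "orthogonal_eigenbasis n a vs (eigenvalues_decr a)"
    using eigenvalues_decr_eigenbasis[OF a] .
  show ?thesis
  proof (rule eigenvalues_decr_eqI)
    show "complex_of_real \<alpha> \<cdot>\<^sub>m a \<in> carrier_mat n n" using a by simp
    have "(complex_of_real \<alpha> \<cdot>\<^sub>m a) *\<^sub>v v = complex_of_real \<alpha> \<cdot>\<^sub>v (a *\<^sub>v v)"
      if "v \<in> carrier_vec n" for v
      using a(1) that by (intro eq_vecI) auto
    then show "orthogonal_eigenbasis n (complex_of_real \<alpha> \<cdot>\<^sub>m a) vs (map ((*) \<alpha>) (eigenvalues_decr a))"
      using vs by (auto simp: orthogonal_eigenbasis_def smult_smult_assoc subset_iff)
    show "sorted_wrt (\<ge>) (map ((*) \<alpha>) (eigenvalues_decr a))"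
      unfolding sorted_wrt_map using sorted_eigenvalues_decr[of a]
      by (rule sorted_wrt_mono_rel[rotated]) (simp add: \<alpha> mult_left_mono)
  qed
qed

text \<open>Unitary conjugation is a similarity, and the list depends only on the characteristic
  polynomial.\<close>

lemma eigenvalues_decr_unitary:
  assumes a: "a \<in> carrier_mat n n" and u: "unitary_mat n u"
  shows "eigenvalues_decr (u * a * mat_adjoint u) = eigenvalues_decr a"
proof -
  have c: "u \<in> carrier_mat n n" "mat_adjoint u \<in> carrier_mat n n"
    using u by (auto simp: unitary_mat_def mat_adjoint_def)
  have "similar_mat (u * a * mat_adjoint u) a"
    using a u c by (intro similar_matI[of _ _ u "mat_adjoint u" n]) (auto simp: unitary_mat_def)
  then show ?thesis by (simp add: eigenvalues_decr_def char_poly_similar)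
qed

text \<open>By \<open>eigenvalues_decr_psd\<close> the entries are the eigenvalues themselves and
  not merely their real parts.\<close>

lemma eigenvalues_decr_nonneg:
  assumes "a \<in> psd_cone n" "x \<in> set (eigenvalues_decr a)"
  shows "0 \<le> x"
proof -
  note a = psd_coneD[OF assms(1)]
  have "complex_of_real x \<in># proots (char_poly a)"
    using assms(2) by (simp flip: eigenvalues_decr_psd[OF assms(1)])
  moreover have "char_poly a \<noteq> 0" using degree_monic_char_poly[OF a(1)] by auto
  ultimately have "poly (char_poly a) (complex_of_real x) = 0" by simp
  then have "eigenvalue a (complex_of_real x)" using eigenvalue_root_char_poly[OF a(1)] by simp
  then show ?thesis using psd_eigenvalue_nonneg[OF assms(1)] by (force simp: less_eq_complex_def)
qed

section \<open>Summation by parts and the properties of \<open>Phi\<close>\<close>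

text \<open>Raising \<open>n\<close> from \<open>m\<close> to \<open>m + 1\<close> replaces
  \<open>eig m a * \<mu> {1..m}\<close> by terms whose net gain is \<open>eig (m + 1) a\<close>
  times the increment of \<open>\<mu>\<close>. For \<open>i = 1\<close> the subtracted set is empty,
  where \<open>\<mu>\<close> is 0.\<close>

lemma Phi_eq_sum_increments:
  assumes "1 \<le> n" "\<mu> {} = 0"
  shows "Phi n \<mu> a = (\<Sum>i = 1..n. eig i a * (\<mu> {1..i} - \<mu> {1..i - 1}))"
  unfolding Phi_def using assms(1)
proof (induction n rule: dec_induct)
  case base
  show ?case by (simp add: assms(2))
next
  case (step m)
  \<comment> \<open>Writing \<open>m\<close> as a successor resolves the truncated subtraction in
    the summation bound.\<close>
  then obtain k where k: "m = Suc k" by (cases m) auto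
  show ?case using step.IH by (simp add: k algebra_simps)
qed

theorem proposition5p3:
  fixes n :: nat and \<mu> :: "nat set \<Rightarrow> real"
  assumes "n \<ge> 1"
    and "finite_monotone_measure {1..n} \<mu>"
  shows "unitarily_invariant n (Phi n \<mu>) \<and>
    monotone_map n (Phi n \<mu>) \<and>
    positive_map n (Phi n \<mu>) \<and>
    (\<forall>\<alpha>::real. \<forall>a \<in> psd_cone n. \<alpha> > 0 \<longrightarrow>
       Phi n \<mu> (complex_of_real \<alpha> \<cdot>\<^sub>m a) = \<alpha> * Phi n \<mu> a)"
proof -
  have \<mu>0: "\<mu> {} = 0" using assms(2) by (simp add: finite_monotone_measure_def)
  have \<mu>: "0 \<le> \<mu> {1..i} - \<mu> {1..i - 1}" if "i \<in> {1..n}" for i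
  proof -
    have "{1..i - 1} \<in> Pow {1..n}" "{1..i} \<in> Pow {1..n}" "{1..i - 1} \<subseteq> {1..i}" using that by auto
    with assms(2) show ?thesis unfolding finite_monotone_measure_def by force
  qed
  note Phi = Phi_eq_sum_increments[of n \<mu>, OF assms(1) \<mu>0]
  have "unitarily_invariant n (Phi n \<mu>)"
    by (auto simp: unitarily_invariant_def Phi_def eig_def eigenvalues_decr_unitary[OF psd_coneD(1)])
  moreover have "monotone_map n (Phi n \<mu>)"
    unfolding monotone_map_def
  proof (rule monotone_onI)
    fix a b assume a: "a \<in> psd_cone n" and b: "b \<in> psd_cone n" and le: "loewner_le n a b"
    \<comment> \<open>\<open>eig\<close> counts from 1 and the list from 0, hence the instance
      \<open>i - 1\<close>.\<close>
    have "eig i a \<le> eig i b" if "i \<in> {1..n}" for i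
      using that eigenvalues_decr_mono[OF psd_coneD(1,2)[OF a] psd_coneD(1,2)[OF b] le, of "i - 1"]
      by (auto simp: eig_def)
    then show "Phi n \<mu> a \<le> Phi n \<mu> b"
      unfolding Phi by (intro sum_mono mult_right_mono \<mu>)
  qed
  moreover have "positive_map n (Phi n \<mu>)"
    unfolding positive_map_def
  proof
    fix a assume a: "a \<in> psd_cone n"
    have "0 \<le> eig i a" if "i \<in> {1..n}" for i
      using that length_eigenvalues_decr[OF psd_coneD(1)[OF a]]
      by (auto simp: eig_def intro!: eigenvalues_decr_nonneg[OF a] nth_mem)
    then show "0 \<le> Phi n \<mu> a"
      unfolding Phi by (intro sum_nonneg mult_nonneg_nonneg \<mu>)
  qed
  moreover have "Phi n \<mu> (complex_of_real \<alpha> \<cdot>\<^sub>m a) = \<alpha> * Phi n \<mu> a"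
    if a: "a \<in> psd_cone n" and \<alpha>: "\<alpha> > 0" for \<alpha> a
  proof -
    have "eig i (complex_of_real \<alpha> \<cdot>\<^sub>m a) = \<alpha> * eig i a" if "i \<in> {1..n}" for i
      using that length_eigenvalues_decr[OF psd_coneD(1)[OF a]] \<alpha>
        eigenvalues_decr_smult[OF psd_coneD(1,2)[OF a], of \<alpha>]
      by (auto simp: eig_def)
    then show ?thesis unfolding Phi by (simp add: sum_distrib_left mult.assoc)
  qed
  ultimately show ?thesis by blast
qed
end
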